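(* Let $X$ be a partially ordered normed space with ordering cone $\mathcal{C}$, and let $x_0\in A\subset X$. Assume that $(-\mathcal{C},\ \overline{\mathrm{cone}}(A-x_0+\mathcal{C}))$ has the strict separation property (SSP). Then $x_0$ is a Benson proper efficient point of $A$ (i.e. $x_0\in\mathrm{Be}(A,\mathcal{C})$) if and only if there exists $(f,\alpha)\in\mathcal{C}^{a\#}_+$ such that $\min_{x\in A} f(x-x_0)+\alpha\|x-x_0\|$ is attained only at $x_0$.
   Context: $X$ is a real normed space with origin $0_X$, dual $X^*$ and unit sphere $S_X$. For $S\subset X$: $\overline S$ is the closure, $\mathrm{bd}(S)$ the boundary, $\mathrm{co}(S)$ the convex hull, $S_0:=S\cup\{0_X\}$, $\mathrm{cone}(S):=\{\lambda s:\lambda\ge0,\ s\in S\}$ and $\overline{\mathrm{cone}}(S)$ is its closure. A cone is a set closed under multiplication by all $\lambda\ge0$; all cones considered are assumed non-trivial (different from $\{0_X\}$ and $X$). A partially ordered normed space with ordering cone $\mathcal{C}$ is a normed space with a (non-trivial) convex cone $\mathcal{C}$ that is pointed, i.e. $(-\mathcal{C})\cap\mathcal{C}=\{0_X\}$. $x_0\in\mathrm{Be}(A,\mathcal{C})$ means $x_0\in A$ and $\overline{\mathrm{cone}}(A+\mathcal{C}-x_0)\cap(-\mathcal{C})=\{0_X\}$. For a cone $\mathcal{C}$, $\mathcal{C}_{\wedge}:=\mathrm{co}(\mathcal{C}\cap S_X)$ and $\mathcal{C}_{\vee}:=\mathrm{co}((\mathrm{bd}(\mathcal{C})\cap S_X)_0)$.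 The pair of cones $(\mathcal{C},\mathcal{K})$ has the strict separation property (SSP) if $0_X\notin\overline{\mathcal{C}_{\wedge}-\mathcal{K}_{\vee}}$ (Minkowski difference). $\mathcal{C}^{\#}:=\{f\in X^*: f(x)>0\ \forall x\in\mathcal{C},\ x\neq0_X\}$ and $\mathcal{C}^{a\#}_+:=\{(f,\alpha)\in\mathcal{C}^{\#}\times(0,\infty): f(x)-\alpha\|x\|>0\ \forall x\in\mathcal{C},\ x\neq0_X\}$. *)

theory Defs
  imports "HOL-Analysis.Analysis"
begin

text \<open>
  On sets, Isabelle's unary and binary minus are complement and set difference. The negative
  \<open>-C\<close> of a set is therefore written \<open>uminus ` C\<close>, and Minkowski sums and
  differences are written as set comprehensions.
\<close>

definition nontrivial_cone :: "'a::real_normed_vector set \<Rightarrow> bool" where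
  "nontrivial_cone C \<longleftrightarrow> cone C \<and> C \<noteq> {0} \<and> C \<noteq> UNIV"

text \<open>Pointedness forces \<open>0 \<in> C\<close>, which excludes the empty set (a \<^const>\<open>cone\<close> in the library).\<close>

definition ordering_cone :: "'a::real_normed_vector set \<Rightarrow> bool" where
  "ordering_cone C \<longleftrightarrow> nontrivial_cone C \<and> convex C \<and> uminus ` C \<inter> C = {0}"

definition cone_gen :: "'a::real_normed_vector set \<Rightarrow> 'a set" where
  "cone_gen S = {l *\<^sub>R s | l s. 0 \<le> l \<and> s \<in> S}"

lemma cone_gen_eq_cone_hull: "cone_gen S = cone hull S"
  unfolding cone_gen_def cone_hull_expl by blast

definition closed_cone_gen :: "'a::real_normed_vector set \<Rightarrow> 'a set" where
  "closed_cone_gen S = closure (cone_gen S)"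

definition shifted_sum :: "'a::real_normed_vector set \<Rightarrow> 'a set \<Rightarrow> 'a \<Rightarrow> 'a set" where
  "shifted_sum A C x0 = {a + c - x0 | a c. a \<in> A \<and> c \<in> C}"

definition Benson_efficient :: "'a::real_normed_vector set \<Rightarrow> 'a set \<Rightarrow> 'a set" where
  "Benson_efficient A C =
    {x0 \<in> A. closed_cone_gen (shifted_sum A C x0) \<inter> uminus ` C = {0}}"

definition cone_wedge :: "'a::real_normed_vector set \<Rightarrow> 'a set" where
  "cone_wedge C = convex hull (C \<inter> sphere 0 1)"

definition cone_vee :: "'a::real_normed_vector set \<Rightarrow> 'a set" where
  "cone_vee C = convex hull (insert 0 (frontier C \<inter> sphere 0 1))"

definition SSP :: "'a::real_normed_vector set \<Rightarrow> 'a set \<Rightarrow> bool" where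
  "SSP C K \<longleftrightarrow> 0 \<notin> closure {x - y | x y. x \<in> cone_wedge C \<and> y \<in> cone_vee K}"

definition dual_sharp :: "'a::real_normed_vector set \<Rightarrow> ('a \<Rightarrow>\<^sub>L real) set" where
  "dual_sharp C = {f. \<forall>x\<in>C. x \<noteq> 0 \<longrightarrow> blinfun_apply f x > 0}"

definition aug_dual_sharp :: "'a::real_normed_vector set \<Rightarrow> (('a \<Rightarrow>\<^sub>L real) \<times> real) set" where
  "aug_dual_sharp C = {(f, \<alpha>). f \<in> dual_sharp C \<and> 0 < \<alpha> \<and>
    (\<forall>x\<in>C. x \<noteq> 0 \<longrightarrow> blinfun_apply f x - \<alpha> * norm x > 0)}"

end

theory Submission imports Defs begin

text \<open>
  Write \<open>K\<close> for the closed cone generated by \<open>A + C - x0\<close>. Strict separation gives, by the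
  Hahn-Banach theorem, a functional \<open>f\<close> and \<open>\<alpha> > 0\<close> with \<open>f c > \<alpha> \<parallel>c\<parallel>\<close> on \<open>C - {0}\<close> and
  \<open>f v + \<alpha> \<parallel>v\<parallel> > 0\<close> on \<open>frontier K - {0}\<close>. The latter extends to \<open>K - {0}\<close>: the set of
  \<open>x \<noteq> 0\<close> with \<open>f x + \<alpha> \<parallel>x\<parallel> \<le> 0\<close> is convex and contains \<open>- C - {0}\<close>, which Benson efficiency
  keeps outside \<open>K\<close>, so a point of it in \<open>K\<close> would produce another one on the frontier. The converse
  is the reverse triangle inequality.
\<close>

section \<open>Hahn-Banach separation in normed spaces\<close>

definition sublinear :: "('a::real_vector \<Rightarrow> real) \<Rightarrow> bool" where
  "sublinear q \<longleftrightarrow> (\<forall>x y. q (x + y) \<le> q x + q y) \<and> (\<forall>t>0. \<forall>x. q (t *\<^sub>R x) \<le> t * q x)"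

lemma sublinear_add: "sublinear q \<Longrightarrow> q (x + y) \<le> q x + q y"
  by (simp add: sublinear_def)

lemma sublinear_scaleR_le: "sublinear q \<Longrightarrow> 0 < t \<Longrightarrow> q (t *\<^sub>R x) \<le> t * q x"
  by (simp add: sublinear_def)

text \<open>The definition asks only for \<open>\<le>\<close>, the form that passes to infima; the
  reverse inequality is the same condition at \<open>inverse t\<close> and
  \<open>t *\<^sub>R x\<close>.\<close>

lemma sublinear_scaleR:
  assumes "sublinear q" "0 < t"
  shows "q (t *\<^sub>R x) = t * q x"
proof (rule antisym)
  show "q (t *\<^sub>R x) \<le> t * q x"
    using assms by (rule sublinear_scaleR_le)
  have "q x \<le> inverse t * q (t *\<^sub>R x)"
    using sublinear_scaleR_le[OF assms(1), of "inverse t" "t *\<^sub>R x"] assms(2) by simp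
  then show "t * q x \<le> q (t *\<^sub>R x)"
    using assms(2) by (simp add: field_simps)
qed

lemma sublinear_zero: "sublinear q \<Longrightarrow> q 0 = 0"
  using sublinear_scaleR[of q 2 0] by simp

lemma sublinear_minus: "sublinear q \<Longrightarrow> - q (- x) \<le> q x"
  using sublinear_add[of q x "- x"] sublinear_zero[of q] by simp

text \<open>The witness \<open>k\<close> may depend on the points as well as the indices, so the
  rule serves chains of functionals, rays \<open>t \<ge> 0\<close> and pairs \<open>(t, m)\<close>
  alike.\<close>

lemma sublinear_INF:
  fixes h :: "'i \<Rightarrow> 'a::real_vector \<Rightarrow> real"
  assumes "I \<noteq> {}"
    and bdd: "\<And>x. bdd_below ((\<lambda>i. h i x) ` I)"
    and add: "\<And>i j x y. i \<in> I \<Longrightarrow> j \<in> I \<Longrightarrow> \<exists>k\<in>I. h k (x + y) \<le> h i x + h j y"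
    and scale: "\<And>i t x. i \<in> I \<Longrightarrow> 0 < t \<Longrightarrow> \<exists>k\<in>I. h k (t *\<^sub>R x) \<le> t * h i x"
  shows "sublinear (\<lambda>x. INF i\<in>I. h i x)"
  unfolding sublinear_def
proof (intro conjI allI impI)
  fix x y
  let ?u = "\<lambda>x. INF i\<in>I. h i x"
  have le: "?u (x + y) \<le> h i x + h j y" if ij: "i \<in> I" "j \<in> I" for i j
  proof -
    obtain k where "k \<in> I" "h k (x + y) \<le> h i x + h j y"
      using add[OF ij] by blast
    then show ?thesis
      using cINF_lower[OF bdd, of k "x + y"] by linarith
  qed
  have "?u (x + y) - h j y \<le> ?u x" if "j \<in> I" for j
    using le that by (intro cINF_greatest \<open>I \<noteq> {}\<close>) (simp add: algebra_simps)
  then have "?u (x + y) - ?u x \<le> ?u y"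
    by (intro cINF_greatest \<open>I \<noteq> {}\<close>) (simp add: algebra_simps)
  then show "?u (x + y) \<le> ?u x + ?u y"
    by simp
next
  fix t :: real and x
  let ?u = "\<lambda>x. INF i\<in>I. h i x"
  assume t: "0 < t"
  have "?u (t *\<^sub>R x) \<le> t * h i x" if i: "i \<in> I" for i
  proof -
    obtain k where "k \<in> I" "h k (t *\<^sub>R x) \<le> t * h i x"
      using scale[OF i t] by blast
    then show ?thesis
      using cINF_lower[OF bdd, of k "t *\<^sub>R x"] by linarith
  qed
  then have "?u (t *\<^sub>R x) / t \<le> ?u x"
    using t by (intro cINF_greatest \<open>I \<noteq> {}\<close>) (simp add: field_simps)
  then show "?u (t *\<^sub>R x) \<le> t * ?u x"
    using t by (simp add: field_simps)
qed

section \<open>Minimal sublinear functionals and the Hahn-Banach theorem\<close>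

lemma minimal_sublinear_exists:
  assumes p: "sublinear p"
  obtains q where "sublinear q" "q \<le> p" "\<And>r. sublinear r \<Longrightarrow> r \<le> q \<Longrightarrow> r = q"
proof -
  let ?S = "{q. sublinear q \<and> q \<le> p}"
  \<comment> \<open>The order is reversed, so that a maximal element in the sense of Zorn is a
    minimal functional and upper bounds of chains are pointwise infima.\<close>
  let ?P = "\<lambda>q r. r \<le> q"
  have "\<exists>m\<in>?S. \<forall>a\<in>?S. ?P m a \<longrightarrow> a = m"
  proof (rule predicate_Zorn)
    show "partial_order_on ?S (relation_of ?P ?S)"
      by (rule partial_order_on_relation_ofI) auto
  next
    fix c assume "c \<in> Chains (relation_of ?P ?S)"
    then have c: "c \<subseteq> ?S" and total: "\<And>q r. q \<in> c \<Longrightarrow> r \<in> c \<Longrightarrow> q \<le> r \<or> r \<le> q"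
      by (auto simp: Chains_def relation_of_def)
    show "\<exists>u\<in>?S. \<forall>a\<in>c. u \<le> a"
    proof (cases "c = {}")
      case True
      then show ?thesis using p by auto
    next
      case False
      let ?u = "\<lambda>x. INF q\<in>c. q x"
      \<comment> \<open>Every \<open>q\<close> in the chain satisfies
        \<open>q x \<ge> - q (- x) \<ge> - p (- x)\<close>, a bound independent of
        \<open>q\<close>.\<close>
      have bdd: "bdd_below ((\<lambda>q. q x) ` c)" for x
      proof (rule bdd_belowI2)
        fix q assume "q \<in> c"
        then have "sublinear q" "q (- x) \<le> p (- x)"
          using c by (auto simp: le_fun_def)
        then show "- p (- x) \<le> q x"
          using sublinear_minus[of q x] by simp
      qed
      have "sublinear ?u"
      proof (rule sublinear_INF[OF False bdd])
        fix q r x y assume qr: "q \<in> c" "r \<in> c"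
        then have "sublinear q" "sublinear r"
          using c by auto
        \<comment> \<open>The smaller of the two comparable functionals is the witness.\<close>
        from sublinear_add[OF this(1), of x y] sublinear_add[OF this(2), of x y]
        show "\<exists>k\<in>c. k (x + y) \<le> q x + r y"
          using total[OF qr] qr unfolding le_fun_def by (meson add_mono order_refl order_trans)
      next
        fix q t x assume "q \<in> c" "0 < (t::real)"
        then show "\<exists>k\<in>c. k (t *\<^sub>R x) \<le> t * q x"
          using c sublinear_scaleR_le by blast
      qed
      moreover have lower: "?u \<le> q" if "q \<in> c" for q
        using cINF_lower[OF bdd that] by (simp add: le_fun_def)
      ultimately show ?thesis
        using False c by (intro bexI[of _ ?u]) (auto intro: order_trans)
    qed
  qed
  then show ?thesis
    using that order_trans by blast
qed

lemma minimal_sublinear_linear: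
  assumes q: "sublinear q" and min: "\<And>r. sublinear r \<Longrightarrow> r \<le> q \<Longrightarrow> r = q"
  shows "linear q"
proof -
  have add_ge: "q x + q y \<le> q (x + y)" for x y
  proof -
    \<comment> \<open>Lowering \<open>q\<close> in direction \<open>y\<close> yields a sublinear functional below \<open>q\<close>, so it changes nothing.\<close>
    let ?h = "\<lambda>t x. q (x + t *\<^sub>R y) - t * q y"
    let ?r = "\<lambda>x. INF t\<in>{0..}. ?h t x"
    \<comment> \<open>Splitting \<open>t *\<^sub>R y\<close> as
      \<open>(x + t *\<^sub>R y) + (- x)\<close> bounds \<open>t * q y\<close>. The value
      \<open>t = 0\<close> is separate because homogeneity is assumed only for positive
      scalars.\<close>
    have bdd: "bdd_below ((\<lambda>t. ?h t x) ` {0..})" for x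
    proof (rule bdd_belowI2)
      fix t :: real assume "t \<in> {0..}"
      then have "q (t *\<^sub>R y) = t * q y"
        using sublinear_scaleR[OF q, of t y] sublinear_zero[OF q] by (cases "t = 0") auto
      then show "- q (- x) \<le> ?h t x"
        using sublinear_add[OF q, of "x + t *\<^sub>R y" "- x"] by simp
    qed
    have "sublinear ?r"
    proof (rule sublinear_INF[OF _ bdd])
      fix s t :: real and u v assume "s \<in> {0..}" "t \<in> {0..}"
      then show "\<exists>k\<in>{0..}. ?h k (u + v) \<le> ?h s u + ?h t v"
        using sublinear_add[OF q, of "u + s *\<^sub>R y" "v + t *\<^sub>R y"]
        by (intro bexI[of _ "s + t"]) (simp_all add: algebra_simps)
    next
      fix s t :: real and u assume "s \<in> {0..}" "0 < t"
      then show "\<exists>k\<in>{0..}. ?h k (t *\<^sub>R u) \<le> t * ?h s u"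
        using sublinear_scaleR_le[OF q, of t "u + s *\<^sub>R y"]
        by (intro bexI[of _ "t * s"]) (simp_all add: algebra_simps)
    qed simp
    moreover have "?r \<le> q"
    proof (rule le_funI)
      show "?r u \<le> q u" for u
        using cINF_lower[OF bdd, of 0 u] by simp
    qed
    ultimately have "?r = q"
      by (rule min)
    then have "q x = ?r x"
      by (rule fun_cong[OF sym])
    \<comment> \<open>The infimum is at most its term at \<open>t = 1\<close>, which is
      superadditivity.\<close>
    also have "\<dots> \<le> q (x + y) - q y"
      using cINF_lower[OF bdd, of 1 x] by simp
    finally show ?thesis
      by simp
  qed
  have add: "q (x + y) = q x + q y" for x y
    using add_ge sublinear_add[OF q] by (rule antisym[rotated])
  have neg: "q (- x) = - q x" for x
    using add[of x "- x"] sublinear_zero[OF q] by simp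
  show ?thesis
  proof (rule linearI)
    fix t x
    show "q (t *\<^sub>R x) = t *\<^sub>R q x"
    proof (cases t "0::real" rule: linorder_cases)
      case less
      then show ?thesis
        using sublinear_scaleR[OF q, of "- t" x] neg[of "t *\<^sub>R x"] by simp
    qed (auto simp: sublinear_zero[OF q] sublinear_scaleR[OF q])
  qed (rule add)
qed

text \<open>There is no subspace to extend from: a minimal sublinear functional below
  \<open>p\<close> is already linear.\<close>

theorem Hahn_Banach_sublinear:
  assumes "sublinear p"
  obtains f where "linear f" "f \<le> p"
  using minimal_sublinear_exists[OF assms] minimal_sublinear_linear by metis

section \<open>Strict separation of a convex set from the origin\<close>

theorem Hahn_Banach_separation:
  fixes M :: "'a::real_normed_vector set"
  assumes "convex M" "0 \<notin> closure M"
  obtains f :: "'a \<Rightarrow>\<^sub>L real" and d where "0 < d" "\<And>m. m \<in> M \<Longrightarrow> d \<le> blinfun_apply f m"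
proof (cases "M = {}")
  case True
  then show ?thesis
    using that[of 1 0] by simp
next
  case False
  \<comment> \<open>\<open>d\<close> is the radius of a ball around the origin that misses
    \<open>M\<close>.\<close>
  obtain d where d: "0 < d" "\<And>m. m \<in> M \<Longrightarrow> d \<le> norm m"
    using assms(2) by (force simp: closure_approachable not_less)
  \<comment> \<open>\<open>?p\<close> is sublinear with \<open>?p x \<le> norm x\<close> and \<open>?p (- m) \<le> - d\<close> on \<open>M\<close>, so any linear
    functional below it is bounded and at least \<open>d\<close> on \<open>M\<close>.\<close>
  let ?I = "{0::real..} \<times> M"
  let ?h = "\<lambda>(t, m) x. norm (x + t *\<^sub>R m) - t * d"
  let ?p = "\<lambda>x. INF i\<in>?I. ?h i x"
  have bdd: "bdd_below ((\<lambda>i. ?h i x) ` ?I)" for x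
  proof (rule bdd_belowI2, clarsimp)
    fix t :: real and m assume tm: "0 \<le> t" "m \<in> M"
    have "t * d \<le> norm (t *\<^sub>R m)"
      using d(2)[OF tm(2)] tm(1) by (simp add: mult_left_mono)
    also have "\<dots> \<le> norm (x + t *\<^sub>R m) + norm x"
      using norm_triangle_ineq4[of "x + t *\<^sub>R m" x] by simp
    finally show "- norm x \<le> norm (x + t *\<^sub>R m) - t * d"
      by simp
  qed
  have lower: "?p x \<le> norm (x + t *\<^sub>R m) - t * d" if "0 \<le> t" "m \<in> M" for t m x
    using cINF_lower[OF bdd, of "(t, m)" x] that by simp
  have "sublinear ?p"
  proof (rule sublinear_INF[OF _ bdd])
    obtain m where "m \<in> M"
      using False by blast
    then have "(0, m) \<in> ?I"
      by simp
    then show "?I \<noteq> {}"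
      by blast
  next
    fix i j x y assume "i \<in> ?I" "j \<in> ?I"
    then obtain s t m n where ij: "i = (s, m)" "j = (t, n)"
      and st: "0 \<le> s" "0 \<le> t" and mn: "m \<in> M" "n \<in> M"
      by auto
    \<comment> \<open>Convexity gives \<open>s M + t M = (s + t) M\<close>; if both weights vanish,
      any point of \<open>M\<close> will do.\<close>
    obtain k where k: "k \<in> M" "(s + t) *\<^sub>R k = s *\<^sub>R m + t *\<^sub>R n"
    proof (cases "s + t = 0")
      case True
      then have "s = 0" "t = 0"
        using st by auto
      then show ?thesis
        using that[OF mn(1)] by simp
    next
      case False
      let ?k = "(s / (s + t)) *\<^sub>R m + (t / (s + t)) *\<^sub>R n"
      have "?k \<in> M"
        using st mn False by (intro convexD[OF assms(1)]) (auto simp: add_divide_distrib[symmetric])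
      moreover have "(s + t) *\<^sub>R ?k = s *\<^sub>R m + t *\<^sub>R n"
        using False by (simp add: scaleR_add_right)
      ultimately show ?thesis
        by (rule that)
    qed
    have "x + y + (s + t) *\<^sub>R k = (x + s *\<^sub>R m) + (y + t *\<^sub>R n)"
      using k(2) by simp
    then have "norm (x + y + (s + t) *\<^sub>R k) \<le> norm (x + s *\<^sub>R m) + norm (y + t *\<^sub>R n)"
      by (metis norm_triangle_ineq)
    then have "?h (s + t, k) (x + y) \<le> ?h i x + ?h j y"
      by (simp add: ij algebra_simps)
    then show "\<exists>k\<in>?I. ?h k (x + y) \<le> ?h i x + ?h j y"
      using k(1) st by (intro bexI[of _ "(s + t, k)"]) auto
  next
    fix i x and t :: real assume "i \<in> ?I" "0 < t"
    then obtain s m where i: "i = (s, m)" "0 \<le> s" "m \<in> M"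
      by auto
    have "t *\<^sub>R x + (t * s) *\<^sub>R m = t *\<^sub>R (x + s *\<^sub>R m)"
      by (simp add: scaleR_add_right)
    then have "norm (t *\<^sub>R x + (t * s) *\<^sub>R m) = t * norm (x + s *\<^sub>R m)"
      using \<open>0 < t\<close> by simp
    then show "\<exists>k\<in>?I. ?h k (t *\<^sub>R x) \<le> t * ?h i x"
      using i \<open>0 < t\<close> by (intro bexI[of _ "(t * s, m)"]) (auto simp: algebra_simps)
  qed
  then obtain f where f: "linear f" "f \<le> ?p"
    by (rule Hahn_Banach_sublinear)
  have f_le: "f x \<le> norm (x + t *\<^sub>R m) - t * d" if "0 \<le> t" "m \<in> M" for t m x
    using le_funD[OF f(2), of x] lower[OF that, of x] by simp
  obtain m0 where "m0 \<in> M"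
    using False by auto
  then have f_norm: "f x \<le> norm x" for x
    using f_le[of 0 m0 x] by simp
  have "\<bar>f x\<bar> \<le> norm x" for x
    using f_norm[of x] f_norm[of "- x"] linear_neg[OF f(1), of x] by simp
  then have "bounded_linear f"
    using f(1) by (intro bounded_linear_intro[where K = 1])
      (auto simp: linear_add linear_scale)
  moreover have "d \<le> f m" if "m \<in> M" for m
    using f_le[of 1 m "- m"] that linear_neg[OF f(1), of m] by simp
  ultimately show ?thesis
    using that[of d "Blinfun f"] d(1) by (simp add: bounded_linear_Blinfun_apply)
qed

section \<open>Benson efficiency\<close>

lemma nonzero_cone_sphere:
  assumes "cone C" "x \<in> C" "x \<noteq> 0"
  shows "x /\<^sub>R norm x \<in> C \<inter> sphere 0 1"
  using assms by (auto simp: cone_def)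

lemma cone_closed_cone_gen: "cone (closed_cone_gen S)"
  by (simp add: closed_cone_gen_def cone_gen_eq_cone_hull cone_closure cone_cone_hull)

text \<open>Scaling by \<open>t > 0\<close> maps both \<open>K\<close> and its complement into
  themselves, hence also their closures, whose intersection is the frontier.\<close>

lemma cone_frontier:
  fixes K :: "'a::real_normed_vector set"
  assumes "cone K" "v \<in> frontier K" "0 < t"
  shows "t *\<^sub>R v \<in> frontier K"
proof -
  have "x \<in> K" if "t *\<^sub>R x \<in> K" for x
  proof -
    have "inverse t *\<^sub>R t *\<^sub>R x \<in> K"
      using assms(1,3) that unfolding cone_def by (meson inverse_nonnegative_iff_nonnegative less_imp_le)
    then show ?thesis
      using assms(3) by simp
  qed
  moreover have "t *\<^sub>R x \<in> K" if "x \<in> K" for x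
    using assms(1,3) that unfolding cone_def by simp
  ultimately have "(*\<^sub>R) t ` K \<subseteq> K" "(*\<^sub>R) t ` (- K) \<subseteq> - K"
    by auto
  then have "(*\<^sub>R) t ` closure K \<subseteq> closure K" "(*\<^sub>R) t ` closure (- K) \<subseteq> closure (- K)"
    by (simp_all add: closure_scaleR closure_mono)
  then show ?thesis
    using assms(2) by (auto simp: frontier_closures)
qed

text \<open>Separation leaves a gap \<open>d\<close> between unit vectors of the two cones, in which
  a strict threshold \<alpha> fits; homogeneity then removes the normalization.\<close>

lemma SSP_separation:
  fixes C K :: "'a::real_normed_vector set"
  assumes "cone C" "C \<noteq> {}" "C \<noteq> {0}" "cone K" "SSP (uminus ` C) K"
  obtains f :: "'a \<Rightarrow>\<^sub>L real" and \<alpha> where "0 < \<alpha>"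
    "\<And>c. c \<in> C \<Longrightarrow> c \<noteq> 0 \<Longrightarrow> \<alpha> * norm c < blinfun_apply f c"
    "\<And>v. v \<in> frontier K \<Longrightarrow> v \<noteq> 0 \<Longrightarrow> 0 < blinfun_apply f v + \<alpha> * norm v"
proof -
  let ?M = "{x - y |x y. x \<in> cone_wedge (uminus ` C) \<and> y \<in> cone_vee K}"
  have "convex ?M"
  proof -
    \<comment> \<open>A union of singletons is the form in which convexity of Minkowski differences
      is available.\<close>
    have "?M = (\<Union>x\<in>cone_wedge (uminus ` C). \<Union>y\<in>cone_vee K. {x - y})"
      by blast
    then show ?thesis
      using convex_differences[of "cone_wedge (uminus ` C)" "cone_vee K"]
      by (simp add: cone_wedge_def cone_vee_def)
  qed
  moreover have "0 \<notin> closure ?M"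
    using assms(5) by (simp add: SSP_def)
  ultimately obtain g :: "'a \<Rightarrow>\<^sub>L real" and d where d: "0 < d"
    and g: "\<And>m. m \<in> ?M \<Longrightarrow> d \<le> blinfun_apply g m"
    by (rule Hahn_Banach_separation) blast
  \<comment> \<open>The sign flips because the first cone is \<open>- C\<close>:
    \<open>g (- c - v) = f c + f v\<close>.\<close>
  define f where "f = - g"
  let ?T = "C \<inter> sphere 0 1"
  have sep: "d \<le> blinfun_apply f c + blinfun_apply f v"
    if "c \<in> ?T" "v \<in> insert 0 (frontier K \<inter> sphere 0 1)" for c v
  proof -
    have "- c \<in> cone_wedge (uminus ` C)" "v \<in> cone_vee K"
      using that unfolding cone_wedge_def cone_vee_def by (auto intro!: hull_inc)
    then have "- c - v \<in> ?M"
      by blast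
    from g[OF this] show ?thesis
      by (simp add: f_def blinfun.bilinear_simps)
  qed
  obtain c0 where "c0 \<in> C" "c0 \<noteq> 0"
    using assms(2,3) by blast
  from nonzero_cone_sphere[OF assms(1) this] have "?T \<noteq> {}"
    by blast
  \<comment> \<open>Half of the gap goes to each side: \<open>f\<close> exceeds \<alpha> by at least
    \<open>d / 2\<close> on unit vectors of \<open>C\<close>, and
    \<open>f v + \<alpha> \<ge> d / 2\<close> on the frontier side. The point \<open>v = 0\<close>
    yields \<open>\<alpha> \<ge> d / 2\<close>.\<close>
  define \<alpha> where "\<alpha> = (INF c\<in>?T. blinfun_apply f c) - d / 2"
  have bdd: "bdd_below (blinfun_apply f ` ?T)"
    using sep[of _ 0] by (intro bdd_belowI2[of _ d]) simp
  have low: "d - blinfun_apply f v \<le> \<alpha> + d / 2" if "v \<in> insert 0 (frontier K \<inter> sphere 0 1)" for v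
    unfolding \<alpha>_def using sep[OF _ that] cINF_greatest[OF \<open>?T \<noteq> {}\<close>, of "d - blinfun_apply f v" "blinfun_apply f"]
    by (simp add: algebra_simps)
  show ?thesis
  proof (rule that[of \<alpha> f])
    show "0 < \<alpha>"
      using low[of 0] d by simp
  next
    fix c assume c: "c \<in> C" "c \<noteq> 0"
    have "\<alpha> < blinfun_apply f (c /\<^sub>R norm c)"
      using cINF_lower[OF bdd nonzero_cone_sphere[OF assms(1) c]] d by (simp add: \<alpha>_def)
    then show "\<alpha> * norm c < blinfun_apply f c"
      using c(2) by (simp add: blinfun.scaleR_right field_simps)
  next
    fix v assume v: "v \<in> frontier K" "v \<noteq> 0"
    have "v /\<^sub>R norm v \<in> frontier K \<inter> sphere 0 1"
      using cone_frontier[OF assms(4) v(1), of "inverse (norm v)"] v(2) by simp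
    then have "0 < blinfun_apply f (v /\<^sub>R norm v) + \<alpha>"
      using low[of "v /\<^sub>R norm v"] d by simp
    then show "0 < blinfun_apply f v + \<alpha> * norm v"
      using v(2) by (simp add: blinfun.scaleR_right field_simps)
  qed
qed

text \<open>The function \<open>f x + \<alpha> * norm x\<close> is convex, so if it were nonpositive
  at \<open>v\<close> it would be so on the whole segment to \<open>w\<close>, which must cross the
  frontier of \<open>K\<close>.\<close>

lemma positive_from_frontier:
  fixes K :: "'a::real_normed_vector set" and f :: "'a \<Rightarrow>\<^sub>L real"
  assumes "0 < \<alpha>"
    and frontier: "\<And>v. v \<in> frontier K \<Longrightarrow> v \<noteq> 0 \<Longrightarrow> 0 < blinfun_apply f v + \<alpha> * norm v"
    and w: "w \<notin> K" "w \<noteq> 0" "blinfun_apply f w + \<alpha> * norm w \<le> 0"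
    and v: "v \<in> K" "v \<noteq> 0"
  shows "0 < blinfun_apply f v + \<alpha> * norm v"
proof (rule ccontr)
  assume "\<not> ?thesis"
  then have fv: "blinfun_apply f v + \<alpha> * norm v \<le> 0"
    by simp
  have "closed_segment v w \<inter> frontier K \<noteq> {}"
    using v(1) w(1) by (intro connected_Int_frontier) auto
  then obtain z where z: "z \<in> closed_segment v w" "z \<in> frontier K"
    by blast
  then obtain u where u: "0 \<le> u" "u \<le> 1" "z = (1 - u) *\<^sub>R v + u *\<^sub>R w"
    by (auto simp: closed_segment_def)
  \<comment> \<open>Strict negativity of \<open>f\<close> at both ends keeps the crossing point away
    from the origin, where the frontier hypothesis is silent.\<close>
  have neg: "blinfun_apply f v < 0" "blinfun_apply f w < 0"
    using fv w(2,3) v(2) \<open>0 < \<alpha>\<close> by (smt (verit) mult_pos_pos zero_less_norm_iff)+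
  have fz: "blinfun_apply f z = (1 - u) * blinfun_apply f v + u * blinfun_apply f w"
    by (simp add: u(3) blinfun.bilinear_simps)
  have "blinfun_apply f z < 0"
    unfolding fz using convex_bound_lt[OF neg, of "1 - u" u] u by simp
  then have "z \<noteq> 0"
    by auto
  have "norm z \<le> (1 - u) * norm v + u * norm w"
    using norm_triangle_ineq[of "(1 - u) *\<^sub>R v" "u *\<^sub>R w"] u by simp
  then have "\<alpha> * norm z \<le> \<alpha> * ((1 - u) * norm v + u * norm w)"
    using \<open>0 < \<alpha>\<close> by simp
  then have "blinfun_apply f z + \<alpha> * norm z
      \<le> (1 - u) * (blinfun_apply f v + \<alpha> * norm v) + u * (blinfun_apply f w + \<alpha> * norm w)"
    unfolding fz by (simp add: algebra_simps)
  also have "\<dots> \<le> 0"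
    using convex_bound_le[OF fv w(3), of "1 - u" u] u by simp
  finally show False
    using frontier[OF z(2) \<open>z \<noteq> 0\<close>] by simp
qed

text \<open>Positive homogeneity carries the inequality to the cone and continuity to its closure;
  the inequality is weak because a strict one could be lost in the limit.\<close>

lemma nonneg_closed_cone_gen:
  fixes f :: "'a::real_normed_vector \<Rightarrow>\<^sub>L real"
  assumes "\<And>s. s \<in> S \<Longrightarrow> 0 \<le> blinfun_apply f s + \<alpha> * norm s" "x \<in> closed_cone_gen S"
  shows "0 \<le> blinfun_apply f x + \<alpha> * norm x"
proof -
  have "closed {x. 0 \<le> blinfun_apply f x + \<alpha> * norm x}"
    by (intro closed_Collect_le continuous_intros)
  moreover have "cone_gen S \<subseteq> {x. 0 \<le> blinfun_apply f x + \<alpha> * norm x}"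
  proof
    fix y assume "y \<in> cone_gen S"
    then obtain l s where y: "0 \<le> l" "s \<in> S" "y = l *\<^sub>R s"
      by (auto simp: cone_gen_def)
    then have "0 \<le> l * (blinfun_apply f s + \<alpha> * norm s)"
      using assms(1) by simp
    then show "y \<in> {x. 0 \<le> blinfun_apply f x + \<alpha> * norm x}"
      using y by (simp add: blinfun.scaleR_right algebra_simps)
  qed
  ultimately show ?thesis
    using assms(2) closure_minimal unfolding closed_cone_gen_def by blast
qed

lemma subset_closed_cone_gen: "S \<subseteq> closed_cone_gen S"
  unfolding closed_cone_gen_def cone_gen_eq_cone_hull
  by (meson closure_subset hull_subset order_trans)

text \<open>The reals are totally ordered, so a point that is not a minimizer has a value strictly
  above the minimum.\<close>

lemma arg_min_singleton_iff:
  fixes \<phi> :: "'a \<Rightarrow> real"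
  shows "{x. is_arg_min \<phi> (\<lambda>x. x \<in> A) x} = {x0} \<longleftrightarrow> x0 \<in> A \<and> (\<forall>x\<in>A. x \<noteq> x0 \<longrightarrow> \<phi> x0 < \<phi> x)"
  (is "?L = _ \<longleftrightarrow> ?R")
proof
  assume L: "?L = {x0}"
  then have x0: "is_arg_min \<phi> (\<lambda>x. x \<in> A) x0"
    by blast
  show ?R
  proof (intro conjI ballI impI)
    show "x0 \<in> A"
      using x0 by (simp add: is_arg_min_def)
    fix x assume x: "x \<in> A" "x \<noteq> x0"
    then have "\<not> is_arg_min \<phi> (\<lambda>x. x \<in> A) x"
      using L by blast
    then show "\<phi> x0 < \<phi> x"
      using x0 x(1) by (force simp: is_arg_min_linorder)
  qed
next
  assume ?R
  then show "?L = {x0}"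
    by (fastforce simp: is_arg_min_linorder)
qed

theorem corollary3p8:
  fixes C A :: "'a::real_normed_vector set" and x0 :: 'a
  assumes "ordering_cone C"
    and "x0 \<in> A"
    and "nontrivial_cone (closed_cone_gen (shifted_sum A C x0))"
    and "SSP (uminus ` C) (closed_cone_gen (shifted_sum A C x0))"
  shows "x0 \<in> Benson_efficient A C \<longleftrightarrow>
    (\<exists>(f, \<alpha>) \<in> aug_dual_sharp C.
      {x. is_arg_min (\<lambda>x. blinfun_apply f (x - x0) + \<alpha> * norm (x - x0)) (\<lambda>x. x \<in> A) x} = {x0})"
proof -
  let ?K = "closed_cone_gen (shifted_sum A C x0)"
  have C: "cone C" "C \<noteq> {0}" "0 \<in> C"
    using assms(1) by (auto simp: ordering_cone_def nontrivial_cone_def)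
  have diff_K: "x - x0 \<in> ?K" if "x \<in> A" for x
  proof (rule subsetD[OF subset_closed_cone_gen])
    show "x - x0 \<in> shifted_sum A C x0"
      unfolding shifted_sum_def mem_Collect_eq
      by (rule exI[of _ x], rule exI[of _ 0]) (simp add: that C(3))
  qed
  show ?thesis
    unfolding arg_min_singleton_iff
  proof
    assume "x0 \<in> Benson_efficient A C"
    then have Be: "?K \<inter> uminus ` C = {0}"
      by (simp add: Benson_efficient_def)
    have "C \<noteq> {}"
      using C(3) by blast
    then obtain f \<alpha> where \<alpha>: "0 < \<alpha>"
      and fC: "\<And>c. c \<in> C \<Longrightarrow> c \<noteq> 0 \<Longrightarrow> \<alpha> * norm c < blinfun_apply f c"
      and fr: "\<And>v. v \<in> frontier ?K \<Longrightarrow> v \<noteq> 0 \<Longrightarrow> 0 < blinfun_apply f v + \<alpha> * norm v"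
      by (rule SSP_separation[OF C(1) _ C(2) cone_closed_cone_gen assms(4)]) (rule that)
    \<comment> \<open>The point \<open>- c\<close> is the one outside \<open>?K\<close> towards
      which the segment argument runs; Benson efficiency keeps it outside.\<close>
    obtain c where c: "c \<in> C" "c \<noteq> 0"
      using C(2,3) by blast
    have not_K: "- c \<notin> ?K"
    proof
      assume "- c \<in> ?K"
      with c(1) have "- c \<in> ?K \<inter> uminus ` C"
        by blast
      then show False
        using c(2) unfolding Be by simp
    qed
    have nonpos: "blinfun_apply f (- c) + \<alpha> * norm (- c) \<le> 0"
      using fC[OF c] by (simp add: blinfun.minus_right)
    have fK: "0 < blinfun_apply f v + \<alpha> * norm v" if "v \<in> ?K" "v \<noteq> 0" for v
      by (rule positive_from_frontier[OF \<alpha> _ not_K _ nonpos that]) (use fr c(2) in auto)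
    have "0 < blinfun_apply f c" if "c \<in> C" "c \<noteq> 0" for c
      using fC[OF that] \<alpha> by (smt (verit) mult_nonneg_nonneg norm_ge_zero)
    then have "(f, \<alpha>) \<in> aug_dual_sharp C"
      using \<alpha> fC by (simp add: aug_dual_sharp_def dual_sharp_def)
    then show "\<exists>(f, \<alpha>) \<in> aug_dual_sharp C. x0 \<in> A \<and> (\<forall>x\<in>A. x \<noteq> x0 \<longrightarrow>
        blinfun_apply f (x0 - x0) + \<alpha> * norm (x0 - x0) < blinfun_apply f (x - x0) + \<alpha> * norm (x - x0))"
      using fK[OF diff_K] assms(2) by (intro bexI[of _ "(f, \<alpha>)"]) auto
  next
    assume "\<exists>(f, \<alpha>) \<in> aug_dual_sharp C. x0 \<in> A \<and> (\<forall>x\<in>A. x \<noteq> x0 \<longrightarrow>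
        blinfun_apply f (x0 - x0) + \<alpha> * norm (x0 - x0) < blinfun_apply f (x - x0) + \<alpha> * norm (x - x0))"
    then obtain f \<alpha> where f: "(f, \<alpha>) \<in> aug_dual_sharp C"
      and min: "\<forall>x\<in>A. x \<noteq> x0 \<longrightarrow> blinfun_apply f (x0 - x0) + \<alpha> * norm (x0 - x0)
        < blinfun_apply f (x - x0) + \<alpha> * norm (x - x0)"
      by auto
    have \<alpha>: "0 < \<alpha>"
      using f by (simp add: aug_dual_sharp_def)
    have fC: "\<alpha> * norm c < blinfun_apply f c" if "c \<in> C" "c \<noteq> 0" for c
      using f that by (auto simp: aug_dual_sharp_def)
    have fA: "0 < blinfun_apply f (x - x0) + \<alpha> * norm (x - x0)" if "x \<in> A" "x \<noteq> x0" for x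
      using min that by simp
    \<comment> \<open>By the reverse triangle inequality, adding \<open>c\<close> lowers the norm
      term by at most \<open>\<alpha> * norm c\<close>, which \<open>f c\<close> makes up for.
      Equality can occur at \<open>a = x0\<close> and \<open>c = 0\<close>, so only the weak bound
      is claimed.\<close>
    have sum: "0 \<le> blinfun_apply f s + \<alpha> * norm s" if sS: "s \<in> shifted_sum A C x0" for s
    proof -
      obtain a c where s: "a \<in> A" "c \<in> C" "s = a + c - x0"
        using sS by (auto simp: shifted_sum_def)
      have "0 \<le> blinfun_apply f (a - x0) + \<alpha> * norm (a - x0)"
        using fA[OF s(1)] by (cases "a = x0") auto
      moreover have "\<alpha> * norm c \<le> blinfun_apply f c"
        using fC[OF s(2)] by (cases "c = 0") auto
      moreover have "\<alpha> * norm (a - x0) \<le> \<alpha> * norm s + \<alpha> * norm c"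
      proof -
        have "a - x0 = s - c"
          by (simp add: s(3))
        then have "\<alpha> * norm (a - x0) \<le> \<alpha> * (norm s + norm c)"
          using norm_triangle_ineq4[of s c] \<alpha> by simp
        then show ?thesis
          by (simp add: distrib_left)
      qed
      moreover have "blinfun_apply f s = blinfun_apply f (a - x0) + blinfun_apply f c"
        by (simp add: s(3) blinfun.bilinear_simps)
      ultimately show ?thesis
        by simp
    qed
    \<comment> \<open>For nonzero \<open>k\<close>, strictness on \<open>C\<close> at
      \<open>- k\<close> contradicts the weak bound on \<open>?K\<close>.\<close>
    have "k = 0" if k: "k \<in> ?K" "k \<in> uminus ` C" for k
    proof (rule ccontr)
      have "- k \<in> C"
        using k(2) by auto
      moreover assume "k \<noteq> 0"
      ultimately have "\<alpha> * norm k < - blinfun_apply f k"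
        using fC[of "- k"] by (simp add: blinfun.minus_right)
      then show False
        using nonneg_closed_cone_gen[OF sum k(1)] by simp
    qed
    moreover have "0 \<in> ?K"
      using diff_K[OF assms(2)] by simp
    moreover have "0 \<in> uminus ` C"
      using C(3) by (rule rev_image_eqI) simp
    ultimately have "?K \<inter> uminus ` C = {0}"
      by blast
    then show "x0 \<in> Benson_efficient A C"
      using assms(2) by (simp add: Benson_efficient_def)
  qed
qed

end
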